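(* $${}_2F_1\left(\tfrac1{10},\tfrac3{10};\tfrac12;\tfrac{125}{128}\right)=\frac16\,2^{3/10}\,\sqrt[10]{3}\,\left(\sqrt5+3\right).$$
   Context: For complex $a,b,c$ with $c\notin\{0,-1,-2,\dots\}$ and $|x|<1$, ${}_2F_1(a,b;c;x)=\sum_{n\ge 0}\frac{(a,n)(b,n)}{(c,n)(1,n)}x^n$ denotes Gauss's hypergeometric series, where $(\alpha,n)=\alpha(\alpha+1)\cdots(\alpha+n-1)$, $(\alpha,0)=1$. All roots are positive real roots. *)

theory Defs
  imports "HOL-Analysis.Analysis"
begin

text \<open>
  Gauss's series. It is intended for \<open>c \<notin> {0,-1,-2,...}\<close> and \<open>norm x < 1\<close>,
  where it converges absolutely.
\<close>

definition hyp2f1 :: "complex \<Rightarrow> complex \<Rightarrow> complex \<Rightarrow> complex \<Rightarrow> complex" where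
  "hyp2f1 a b c x =
     (\<Sum>n. (pochhammer a n * pochhammer b n) / (pochhammer c n * pochhammer 1 n) * x ^ n)"

end

(*
  Euler's integral expresses the value as the integral over [0,1] of
  w(t) = t^(-7/10) (1-t)^(-4/5) (1 - 125t/128)^(-1/10), divided by Beta(3/10,1/5).
  As the argument 125/128 is a CM point, w is a pullback of a Beta integrand: the map
    W = (27/2) t (1 - 125t/128)^3 / ((1-t) (1 - 25t/16)^5)
  of degree 6 satisfies 1 + W = C(t)^2 / ((1-t) (1 - 25t/16)^5) with a cubic C, and
    w dt = (27/2)^(-3/10) |W|^(-7/10) |1+W|^(-1/2) |dW|.
  On [0,1] the real point W runs from 0 to infinity (the pole is at t = 16/25), then on the
  negative axis from infinity to -1 (at the root of C) and back. The first stretch contributes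
  Beta(3/10,1/5) and each of the other two contributes Beta(1/5,1/2) = sin(3 pi/10) Beta(3/10,1/5).
*)
theory Submission
  imports Defs
begin

section \<open>Incomplete Beta function and substitution in Beta integrals\<close>

definition incomplete_Beta :: "real \<Rightarrow> real \<Rightarrow> real \<Rightarrow> real" where
  "incomplete_Beta p q v = integral {0..v} (\<lambda>u. u powr (p - 1) * (1 - u) powr (q - 1))"

lemma incomplete_Beta_0 [simp]: "incomplete_Beta p q 0 = 0"
  by (simp add: incomplete_Beta_def)

lemma incomplete_Beta_1: "p > 0 \<Longrightarrow> q > 0 \<Longrightarrow> incomplete_Beta p q 1 = Beta p q"
  unfolding incomplete_Beta_def by (intro integral_unique has_integral_Beta_real)

text \<open>The Beta integrand may be unbounded near 0 and 1, but it is integrable there, and this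
  makes its indefinite integral continuous up to both endpoints.\<close>

lemma continuous_on_incomplete_Beta:
  assumes "p > 0" "q > 0"
  shows "continuous_on {0..1} (incomplete_Beta p q)"
  unfolding incomplete_Beta_def
  by (intro indefinite_integral_continuous_1 integrable_Beta' assms)

lemma has_field_derivative_incomplete_Beta:
  assumes "p > 0" "q > 0" "0 < v" "v < 1"
  shows "(incomplete_Beta p q has_field_derivative v powr (p - 1) * (1 - v) powr (q - 1)) (at v)"
proof -
  let ?f = "\<lambda>u::real. u powr (p - 1) * (1 - u) powr (q - 1)"
  have "isCont ?f v"
    using assms by (intro continuous_intros) auto
  hence "((\<lambda>u. integral {0..u} ?f) has_vector_derivative ?f v) (at v within ({0..1} - {}))"
    using assms
    by (intro integral_has_vector_derivative_continuous_at integrable_Beta')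
       (auto intro: continuous_at_imp_continuous_within)
  hence "(incomplete_Beta p q has_vector_derivative ?f v) (at v within {0..1})"
    by (simp add: incomplete_Beta_def [abs_def])
  moreover have "at v within {0..1} = at v"
    using assms by (intro at_within_Icc_at) auto
  ultimately show ?thesis
    by (simp add: has_real_derivative_iff_has_vector_derivative)
qed

text \<open>
  The values of \<open>f\<close> at \<open>l\<close> and \<open>r\<close> are left free, since \<open>0 powr x = 0\<close> would spoil
  the identity there.
\<close>
lemma has_integral_Beta_substitution:
  fixes f g g' :: "real \<Rightarrow> real"
  assumes "p > 0" "q > 0" "l \<le> r"
    and contg: "continuous_on {l..r} g" and ends: "g l \<in> {0..1}" "g r \<in> {0..1}"
    and interior: "\<And>t. t \<in> {l<..<r} \<Longrightarrow> g t \<in> {0<..<1}"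
    and deriv: "\<And>t. t \<in> {l<..<r} \<Longrightarrow> (g has_field_derivative g' t) (at t)"
    and f: "\<And>t. t \<in> {l<..<r} \<Longrightarrow> f t = k * (g t powr (p - 1) * (1 - g t) powr (q - 1) * g' t)"
  shows "(f has_integral k * (incomplete_Beta p q (g r) - incomplete_Beta p q (g l))) {l..r}"
proof -
  have range: "g t \<in> {0..1}" if "t \<in> {l..r}" for t
  proof -
    have "t = l \<or> t = r \<or> t \<in> {l<..<r}" using that by auto
    thus ?thesis using ends interior[of t] by auto
  qed
  have "(f has_integral k * incomplete_Beta p q (g r) - k * incomplete_Beta p q (g l)) {l..r}"
  \<comment> \<open>Continuity is asked for on the closed interval, the derivative only inside it,
    so singular endpoints are allowed.\<close>
  proof (rule fundamental_theorem_of_calculus_interior)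
    show "continuous_on {l..r} (\<lambda>t. k * incomplete_Beta p q (g t))"
      using range
      by (intro continuous_on_mult continuous_on_const
            continuous_on_compose2[OF continuous_on_incomplete_Beta contg] assms) auto
  next
    fix t assume t: "t \<in> {l<..<r}"
    have "((\<lambda>t. k * incomplete_Beta p q (g t)) has_field_derivative f t) (at t)"
      unfolding f[OF t] using interior[OF t] assms
      by (intro DERIV_cmult DERIV_chain2[OF has_field_derivative_incomplete_Beta deriv[OF t]]) auto
    thus "((\<lambda>t. k * incomplete_Beta p q (g t)) has_vector_derivative f t) (at t)"
      by (simp add: has_real_derivative_iff_has_vector_derivative)
  qed fact
  thus ?thesis by (simp only: right_diff_distrib)
qed

section \<open>Euler's integral for the hypergeometric series\<close>

lemma Beta_real_pos: "a > 0 \<Longrightarrow> b > 0 \<Longrightarrow> Beta a b > (0 :: real)"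
  by (simp add: Beta_def Gamma_real_pos)

text \<open>\<open>Gamma (b + n) = pochhammer b n * Gamma b\<close>, likewise for \<open>c\<close>,
  and the arguments of the left Beta value add up to \<open>c + n\<close>. This produces the
  \<open>b\<close> and \<open>c\<close> factors of the hypergeometric coefficients.\<close>

lemma Beta_pochhammer:
  fixes b c :: real
  assumes "0 < b" "b < c"
  shows "Beta (b + real n) (c - b) = pochhammer b n / pochhammer c n * Beta b (c - b)"
proof -
  have "b \<notin> \<int>\<^sub>\<le>\<^sub>0" "c \<notin> \<int>\<^sub>\<le>\<^sub>0"
    using assms by (auto elim!: nonpos_Ints_cases)
  moreover have "Gamma b > 0" "Gamma c > 0" "Gamma (c + real n) > 0"
    using assms by (auto intro!: Gamma_real_pos)
  ultimately show ?thesis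
    by (simp add: Beta_def pochhammer_Gamma field_simps)
qed

text \<open>Newton's binomial series: the sign \<open>(-1)^n\<close> turns
  \<open>(-a) gchoose n\<close> into \<open>pochhammer a n / fact n\<close>.\<close>

lemma sums_binomial_pochhammer:
  fixes a z :: real
  assumes "\<bar>z\<bar> < 1"
  shows "(\<lambda>n. pochhammer a n / fact n * z ^ n) sums (1 - z) powr (-a)"
proof -
  have "(\<lambda>n. ((-a) gchoose n) * (-z) ^ n) sums (1 + (-z)) powr (-a)"
    using assms by (intro gen_binomial_real) auto
  moreover have "((-a) gchoose n) * (-z) ^ n = pochhammer a n / fact n * z ^ n" for n
    by (simp add: gbinomial_pochhammer flip: power_mult_distrib)
  ultimately show ?thesis by simp
qed

text \<open>Expand \<open>(1 - x * t) powr (-a)\<close> by the binomial series and integrate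
  termwise; each term is a Beta integral. As \<open>a > 0\<close> and \<open>x \<ge> 0\<close>, all
  terms are nonnegative, so monotone convergence justifies the exchange.\<close>

lemma hypergeometric_sums_Euler_integral:
  fixes a b c x I :: real
  assumes a: "0 < a" and b: "0 < b" "b < c" and x: "0 \<le> x" "x < 1"
    and int: "((\<lambda>t. t powr (b - 1) * (1 - t) powr (c - b - 1) * (1 - x * t) powr (-a))
                has_integral I) {0..1}"
  shows "(\<lambda>n. pochhammer a n * pochhammer b n / (pochhammer c n * pochhammer 1 n) * x ^ n)
           sums (I / Beta b (c - b))"
proof -
  define T where "T = (\<lambda>n t. t powr (b - 1) * (1 - t) powr (c - b - 1)
                        * (pochhammer a n / fact n * (x * t) ^ n))"
  define \<omega> where "\<omega> = (\<lambda>t. t powr (b - 1) * (1 - t) powr (c - b - 1) * (1 - x * t) powr (-a))"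
  define K where "K = (\<lambda>n. pochhammer a n / fact n * x ^ n * Beta (b + real n) (c - b))"
  have T_nonneg: "T n t \<ge> 0" if "t \<in> {0..1}" for n t
    unfolding T_def using that a x by (auto intro!: mult_nonneg_nonneg divide_nonneg_nonneg pochhammer_nonneg)
  have T_int: "(T n has_integral K n) {0..1}" for n
  proof -
    have "((\<lambda>t. pochhammer a n / fact n * x ^ n * (t powr (b + real n - 1) * (1 - t) powr (c - b - 1)))
            has_integral K n) {0..1}"
      unfolding K_def using b by (intro has_integral_mult_right has_integral_Beta_real) auto
    moreover have "pochhammer a n / fact n * x ^ n * (t powr (b + real n - 1) * (1 - t) powr (c - b - 1)) = T n t"
      if "t \<in> {0..1}" for t
    \<comment> \<open>Both sides vanish at 0 because \<open>0 powr y = 0\<close> for every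
      \<open>y\<close>; elsewhere the exponents add.\<close>
    proof (cases "t = 0")
      case False
      hence "t powr (b + real n - 1) = t powr (b - 1) * t ^ n"
        using that by (simp add: powr_realpow [symmetric] powr_add [symmetric] algebra_simps)
      thus ?thesis by (simp add: T_def power_mult_distrib mult_ac)
    qed (simp add: T_def)
    ultimately show ?thesis by (rule has_integral_eq[rotated])
  qed
  have T_sums: "(\<lambda>n. T n t) sums \<omega> t" if "t \<in> {0..1}" for t
  proof -
    have "x * t \<le> x * 1" using that x by (intro mult_left_mono) auto
    hence "\<bar>x * t\<bar> < 1" using that x by (simp add: abs_mult)
    thus ?thesis unfolding T_def \<omega>_def by (intro sums_mult sums_binomial_pochhammer)
  qed
  define S where "S = (\<lambda>k t. \<Sum>n<k. T n t)"
  have S_int: "(S k has_integral (\<Sum>n<k. K n)) {0..1}" for k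
    unfolding S_def by (intro has_integral_sum T_int) auto
  have S_le: "S k t \<le> \<omega> t" if "t \<in> {0..1}" for k t
    unfolding S_def using T_sums[OF that] T_nonneg[OF that]
    by (metis sums_unique sums_summable sum_le_suminf finite_lessThan)
  \<comment> \<open>Comparison with the full integrand supplies the bound that monotone convergence
    asks for.\<close>
  have K_le: "(\<Sum>n<k. K n) \<le> I" for k
    using has_integral_le[OF S_int int[folded \<omega>_def]] S_le by (simp add: \<omega>_def)
  have K_nonneg: "K n \<ge> 0" for n
    using has_integral_nonneg[OF T_int] T_nonneg by blast
  have "\<omega> integrable_on {0..1} \<and> (\<lambda>k. integral {0..1} (S k)) \<longlonglongrightarrow> integral {0..1} \<omega>"
  proof (rule monotone_convergence_increasing)
    show "S k integrable_on {0..1}" for k using S_int by blast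
    show "S k t \<le> S (Suc k) t" if "t \<in> {0..1}" for k t
      using T_nonneg[OF that] by (simp add: S_def)
    show "(\<lambda>k. S k t) \<longlonglongrightarrow> \<omega> t" if "t \<in> {0..1}" for t
      using T_sums[OF that] by (simp add: sums_def S_def)
    have "integral {0..1} (S k) \<in> {0..I}" for k
      using K_le[of k] sum_nonneg[of "{..<k}" K] K_nonneg integral_unique[OF S_int[of k]] by simp
    hence "range (\<lambda>k. integral {0..1} (S k)) \<subseteq> {0..I}" by blast
    thus "bounded (range (\<lambda>k. integral {0..1} (S k)))"
      using bounded_closed_interval bounded_subset by blast
  qed
  hence "K sums I"
    using integral_unique[OF S_int] integral_unique[OF int] by (simp add: sums_def \<omega>_def)
  hence "(\<lambda>n. K n / Beta b (c - b)) sums (I / Beta b (c - b))"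
    by (rule sums_divide)
  moreover have "Beta b (c - b) \<noteq> 0"
    using b Beta_real_pos[of b "c - b"] by simp
  hence "K n / Beta b (c - b) = pochhammer a n * pochhammer b n / (pochhammer c n * pochhammer 1 n) * x ^ n" for n
    unfolding K_def Beta_pochhammer[OF b] by (simp add: pochhammer_fact field_simps)
  ultimately show ?thesis by simp
qed

section \<open>Ratio of the two Beta values\<close>

text \<open>Descends from the complex identity for the entire function \<open>rGamma\<close>. At
  integers both sides are 0, by the conventions for Gamma at its poles and for division by
  0.\<close>

lemma Gamma_reflection_real:
  fixes z :: real
  shows "Gamma z * Gamma (1 - z) = pi / sin (pi * z)"
proof -
  have "complex_of_real (rGamma z * rGamma (1 - z)) = of_real (sin (pi * z) / pi)"
    using rGamma_reflection_complex[of "complex_of_real z"]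
    by (simp only: of_real_mult of_real_divide of_real_diff of_real_1 rGamma_complex_of_real [symmetric]
        sin_of_real [symmetric])
  hence "rGamma z * rGamma (1 - z) = sin (pi * z) / pi"
    by (simp only: of_real_eq_iff)
  moreover have "Gamma z * Gamma (1 - z) = inverse (rGamma z * rGamma (1 - z))"
    by (simp add: Gamma_def)
  ultimately show ?thesis by simp
qed

text \<open>The quotient of the Beta values is
  \<open>Gamma (1/2)^2 / (Gamma (3/10) * Gamma (7/10))\<close>, where the numerator is
  \<open>pi\<close> and reflection evaluates the denominator.\<close>

lemma Beta_fifth_half: "Beta (1/5) (1/2) = sin (3 * pi / 10) * Beta (3/10) (1/5 :: real)"
proof -
  have "Gamma (3/10) * Gamma (7/10 :: real) = pi / sin (3 * pi / 10)"
    using Gamma_reflection_real[of "3/10"] by (simp add: mult.commute)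
  moreover have "Gamma (3/10 :: real) > 0" "Gamma (7/10 :: real) > 0"
    by (auto intro!: Gamma_real_pos)
  moreover have "sin (3 * pi / 10) > 0"
    by (intro sin_gt_zero) auto
  ultimately have square: "Gamma (1/2) * Gamma (1/2) = sin (3 * pi / 10) * Gamma (3/10) * Gamma (7/10 :: real)"
    by (simp add: Gamma_one_half_real field_simps)
  have "Gamma (1/5) * Gamma (1/2) * Gamma (1/2) = sin (3 * pi / 10) * (Gamma (3/10) * Gamma (1/5)) * Gamma (7/10 :: real)"
    unfolding mult.assoc square by (simp only: mult_ac)
  moreover have "Gamma (1/2 :: real) \<noteq> 0"
    by (simp add: Gamma_one_half_real)
  moreover have "Gamma (7/10 :: real) \<noteq> 0"
    using \<open>Gamma (7/10 :: real) > 0\<close> by (rule less_imp_neq [symmetric])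
  ultimately have "Gamma (1/5) * Gamma (1/2) / Gamma (7/10) =
      sin (3 * pi / 10) * (Gamma (3/10) * Gamma (1/5)) / Gamma (1/2 :: real)"
    by (simp only: frac_eq_eq not_False_eq_True)
  thus ?thesis
    by (simp add: Beta_def)
qed

text \<open>The value equals \<open>cos (pi/5)\<close>. Since \<open>2*pi/5\<close> and
  \<open>3*pi/5\<close> are supplementary, the double and triple angle formulas give a cubic
  equation for it.\<close>

lemma sin_3pi_10: "sin (3 * pi / 10) = (1 + sqrt 5) / 4"
proof -
  define c where "c = cos (pi / 5)"
  have "c > 0"
    unfolding c_def by (intro cos_gt_zero) auto
  have "4 * c ^ 3 - 3 * c = cos (3 * (pi / 5))"
    by (simp only: c_def cos_treble_cos)
  also have "\<dots> = - cos (pi - 3 * (pi / 5))"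
    by (simp only: cos_diff cos_pi sin_pi)
  also have "pi - 3 * (pi / 5) = 2 * (pi / 5)"
    by simp
  also have "cos \<dots> = 2 * c\<^sup>2 - 1"
    by (simp only: c_def cos_double_cos)
  finally have "4 * c ^ 3 - 3 * c = - (2 * c\<^sup>2 - 1)" .
  \<comment> \<open>The cubic is \<open>(c + 1) * (4*c^2 - 2*c - 1)\<close>; a factor 4 completes
    the square.\<close>
  hence "(c + 1) * ((4 * c - 1)\<^sup>2 - 5) = 0"
    by (simp add: power2_eq_square power3_eq_cube algebra_simps)
  hence "(4 * c - 1)\<^sup>2 = 5"
    using \<open>c > 0\<close> by simp
  moreover have "4 * c - 1 \<ge> 0"
  proof (rule ccontr)
    assume "\<not> ?thesis"
    hence "\<bar>4 * c - 1\<bar> < 1"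
      using \<open>c > 0\<close> by auto
    hence "(4 * c - 1)\<^sup>2 < 1"
      by (simp add: abs_square_less_1)
    thus False using \<open>(4 * c - 1)\<^sup>2 = 5\<close> by simp
  qed
  ultimately have "sqrt 5 = 4 * c - 1"
    by (intro real_sqrt_unique)
  moreover have "sin (3 * pi / 10) = c"
    unfolding c_def sin_cos_eq by (rule arg_cong[where f = cos]) (simp add: field_simps)
  ultimately show ?thesis by simp
qed

section \<open>The covering map of degree 6 and its cubic\<close>

text \<open>The map is \<open>W = 27/2 * t * polyD t ^ 3 / ((1 - t) * polyA t ^ 5)\<close>. Its
  zeros have orders 1, 3, 2 (at 0, 128/125, infinity), its poles orders 1 and 5, and
  \<open>1 + W\<close> has three double zeros, the roots of \<open>polyC\<close>. By Riemann-Hurwitz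
  there is no other ramification, which is why the Wronskian below is just
  \<open>polyA t ^ 4\<close>.\<close>

definition polyA :: "real \<Rightarrow> real" where "polyA t = 1 - 25/16 * t"
definition polyD :: "real \<Rightarrow> real" where "polyD t = 1 - 125/128 * t"
definition polyC :: "real \<Rightarrow> real" where
  "polyC t = 1 + 75/32 * t - 13125/2048 * t^2 + 3125/1024 * t^3"

text \<open>The formula for \<open>1 + W\<close> cleared of denominators; it factors
  \<open>1 - g\<close> on the left segment and \<open>g\<close> on the right ones.\<close>

lemma cover_identity: "(polyC t)\<^sup>2 = (1 - t) * polyA t ^ 5 + 27/2 * t * polyD t ^ 3"
  unfolding polyA_def polyC_def polyD_def by (simp add: eval_nat_numeral field_simps)

lemma polyC_pos: assumes "0 \<le> t" "t \<le> 16/25" shows "polyC t > 0"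
proof -
  \<comment> \<open>Rescaled so that the root 16/25 of \<open>polyA\<close> becomes 1. The bounds
    below combine to \<open>polyC t \<ge> 1 - 5/8 * u\<close>.\<close>
  define u where "u = 25/16 * t"
  have u: "0 \<le> u" "u \<le> 1" using assms by (auto simp: u_def)
  have "polyC t = 1 + 3/2 * u - 21/8 * u^2 + 4/5 * u^3"
    by (simp add: polyC_def u_def power2_eq_square power3_eq_cube)
  moreover have "u^2 \<le> u" 
    using u mult_left_le[of u u] by (simp add: power2_eq_square)
  moreover have "8/10*(u^3) - u^2 \<ge> - (1/2) * u"
  proof -
    have "4/5*u^3 - u^2 + 1/2*u = u * (4/5 * (u - 5/8)^2 + 3/16)"
      by (simp add: power2_eq_square power3_eq_cube algebra_simps)
    moreover have "\<dots> \<ge> 0" using u by (intro mult_nonneg_nonneg) auto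
    ultimately show ?thesis by linarith
  qed
  ultimately show ?thesis using u by linarith
qed

lemma DERIV_polyC: "(polyC has_field_derivative 75/32 - 13125/1024 * t + 9375/1024 * t^2) (at t)"
  unfolding polyC_def [abs_def] by (auto intro!: derivative_eq_intros)

lemma polyC_strict_antimono:
  assumes "16/25 \<le> s" "s < t" "t \<le> 1"
  shows "polyC t < polyC s"
proof (rule DERIV_neg_imp_decreasing[where f = polyC and a = s and b = t])
  fix y assume y: "s \<le> y" "y \<le> t"
  \<comment> \<open>The chord of \<open>y^2\<close> over [16/25, 1] bounds the derivative by
    \<open>(2250 * y - 3600) / 1024\<close>.\<close>
  have "(y - 16/25) * (1 - y) \<ge> 0"
    using y assms by (intro mult_nonneg_nonneg) auto
  hence "y^2 \<le> 41/25 * y - 16/25" by (simp add: power2_eq_square field_simps)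
  hence "75/32 - 13125/1024 * y + 9375/1024 * y^2 < 0" using y assms by simp
  thus "\<exists>d. (polyC has_field_derivative d) (at y) \<and> d < 0" using DERIV_polyC by blast
qed (use assms in auto)

text \<open>The sign changes: \<open>polyC (16/25) = 27/40\<close> and
  \<open>polyC 1 = -27/2048\<close>. At the root, \<open>W\<close> turns back at -1.\<close>

lemma polyC_root: "\<exists>r. 16/25 < r \<and> r < 1 \<and> polyC r = 0"
proof -
  have "\<exists>r\<ge>16/25. r \<le> 1 \<and> polyC r = 0"
    by (intro IVT2') (auto simp: polyC_def power2_eq_square power3_eq_cube intro!: continuous_intros)
  then obtain r where "r \<ge> 16/25" "r \<le> 1" "polyC r = 0" by blast
  moreover have "polyC 1 \<noteq> 0" "polyC (16/25) \<noteq> 0" by (auto simp: polyC_def power2_eq_square power3_eq_cube)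
  ultimately have "r \<noteq> 1" "r \<noteq> 16/25" by metis+
  thus ?thesis using \<open>r \<ge> _\<close> \<open>r \<le> _\<close> \<open>polyC r = 0\<close> by (intro exI[of _ r]) auto
qed

section \<open>Euler's integrand as a pullback on each segment\<close>

definition euler_integrand :: "real \<Rightarrow> real" where
  "euler_integrand t = t powr (-7/10) * (1 - t) powr (-4/5) * polyD t powr (-1/10)"

lemma DERIV_t_polyD_cubed: "((\<lambda>t. t * polyD t ^ 3) has_field_derivative polyD t ^ 2 * (1 - 125/32 * t)) (at t)"
proof -
  have "(polyD has_field_derivative -125/128) (at t)"
    unfolding polyD_def [abs_def] by (auto intro!: derivative_eq_intros)
  hence "((\<lambda>t. t * polyD t ^ 3) has_field_derivative
          1 * polyD t ^ 3 + (of_nat 3 * (-125/128 * polyD t ^ (3 - Suc 0))) * t) (at t)"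
    by (intro DERIV_mult DERIV_power DERIV_ident)
  also have "1 * polyD t ^ 3 + (of_nat 3 * (-125/128 * polyD t ^ (3 - Suc 0))) * t = polyD t ^ 2 * (polyD t - 375/128 * t)"
    by (simp add: power2_eq_square power3_eq_cube algebra_simps)
  also have "polyD t - 375/128 * t = 1 - 125/32 * t"
    by (simp add: polyD_def)
  finally show ?thesis .
qed

text \<open>The left-hand side is the nontrivial factor of the numerator of \<open>(t (polyD t)^3 / (polyC t)^2)'\<close>.\<close>
lemma wronskian_identity:
  "(1 - 125/32 * t) * polyC t - 2 * t * polyD t * (75/32 - 13125/1024 * t + 9375/1024 * t^2) = polyA t ^ 4"
  unfolding polyA_def polyC_def polyD_def by (simp add: eval_nat_numeral field_simps)

text \<open>Here \<open>g = W / (1 + W)\<close>.\<close>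
lemma has_integral_left_segment: "(euler_integrand has_integral (27/2) powr (-3/10) * Beta (3/10) (1/5)) {0..16/25}"
proof -
  define g where "g = (\<lambda>t. 27/2 * (t * polyD t ^ 3 / (polyC t)\<^sup>2))"
  define g' where "g' = (\<lambda>t. 27/2 * (polyD t ^ 2 * polyA t ^ 4 / polyC t ^ 3))"
  have g_compl: "1 - g t = (1 - t) * polyA t ^ 5 / (polyC t)\<^sup>2" if "polyC t \<noteq> 0" for t
  proof -
    have "(1 - t) * polyA t ^ 5 = (polyC t)\<^sup>2 - 27/2 * t * polyD t ^ 3"
      using cover_identity[of t] by simp
    thus ?thesis using that by (simp add: g_def diff_divide_distrib)
  qed
  have deriv: "(g has_field_derivative g' t) (at t)" if "polyC t \<noteq> 0" for t
  proof -
    let ?c = "75/32 - 13125/1024 * t + 9375/1024 * t^2"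
    have "((\<lambda>t. (polyC t)\<^sup>2) has_field_derivative of_nat 2 * (?c * polyC t ^ (2 - Suc 0))) (at t)"
      by (intro DERIV_power DERIV_polyC)
    hence "(g has_field_derivative
       27/2 * ((polyD t ^ 2 * (1 - 125/32 * t) * (polyC t)\<^sup>2 - t * polyD t ^ 3 * (of_nat 2 * (?c * polyC t ^ (2 - Suc 0))))
         / ((polyC t)\<^sup>2 * (polyC t)\<^sup>2))) (at t)"
      unfolding g_def using that by (intro DERIV_cmult DERIV_divide DERIV_t_polyD_cubed) auto
    \<comment> \<open>Taking out \<open>polyD t ^ 2\<close> and one factor \<open>polyC t\<close>
      leaves the left-hand side of \<open>wronskian_identity\<close>.\<close>
    also have "(polyD t ^ 2 * (1 - 125/32 * t) * (polyC t)\<^sup>2 - t * polyD t ^ 3 * (of_nat 2 * (?c * polyC t ^ (2 - Suc 0))))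
         / ((polyC t)\<^sup>2 * (polyC t)\<^sup>2)
       = (polyC t * (polyD t ^ 2 * ((1 - 125/32 * t) * polyC t - 2 * t * polyD t * ?c))) / (polyC t * polyC t ^ 3)"
      by (rule arg_cong2[where f = "(/)"]) (simp_all add: power2_eq_square power3_eq_cube algebra_simps)
    also have "\<dots> = polyD t ^ 2 * polyA t ^ 4 / polyC t ^ 3"
      using that by (simp only: wronskian_identity) simp
    finally show ?thesis by (simp add: g'_def)
  qed
  have A_pos: "polyA t > 0" if "t < 16/25" for t using that by (simp add: polyA_def)
  have D_pos: "polyD t > 0" if "t \<le> 1" for t using that by (simp add: polyD_def)
  have interior: "g t \<in> {0<..<1}" if "t \<in> {0<..<16/25}" for t
  proof -
    have "polyC t > 0" using that by (intro polyC_pos) auto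
    moreover have "g t > 0" unfolding g_def using that D_pos[of t] \<open>polyC t > 0\<close> by auto
    moreover have "1 - g t > 0"
      using that A_pos[of t] \<open>polyC t > 0\<close> by (subst g_compl) auto
    ultimately show ?thesis by simp
  qed
  have g_ends: "g 0 = 0" "g (16/25) = 1"
    by (simp_all add: g_def polyC_def polyD_def power2_eq_square power3_eq_cube)
  \<comment> \<open>With \<open>W = g / (1 - g)\<close>, the form
    \<open>|W|^(-7/10) |1+W|^(-1/2) dW\<close> becomes
    \<open>g^(-7/10) (1-g)^(-4/5) dg\<close>.\<close>
  have integrand_eq: "euler_integrand t = (27/2) powr (-3/10) * (g t powr (3/10 - 1) * (1 - g t) powr (1/5 - 1) * g' t)"
    if "t \<in> {0<..<16/25}" for t
  proof -
    have t: "0 < t" "t < 16/25" using that by auto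
    have pos: "polyA t > 0" "polyC t > 0" "polyD t > 0" "1 - t > 0"
      using t A_pos D_pos polyC_pos by auto
    \<comment> \<open>All factors are positive, so the identity is linear in their logarithms; the
      coefficients of \<open>a\<close>, \<open>c\<close> and \<open>e\<close> cancel.\<close>
    define a c d e where "a = ln (polyA t)" and "c = ln (polyC t)" and "d = ln (polyD t)" and "e = ln (27/2 :: real)"
    have ln_g: "ln (g t) = e + ln t + 3 * d - 2 * c"
      unfolding g_def a_def c_def d_def e_def using pos t
      by (simp add: ln_mult ln_div ln_realpow del: ln_divide_pos)
    have ln_g1: "ln (1 - g t) = ln (1 - t) + 5 * a - 2 * c"
      using pos t by (subst g_compl) (simp_all add: a_def c_def d_def ln_mult ln_div ln_realpow)
    have "g' t > 0"
      unfolding g'_def using pos by simp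
    moreover have "ln (g' t) = e + 2 * d + 4 * a - 3 * c"
      unfolding g'_def a_def c_def d_def e_def using pos
      by (simp add: ln_mult ln_div ln_realpow del: ln_divide_pos)
    ultimately have g'_exp: "g' t = exp (e + 2 * d + 4 * a - 3 * c)"
      by (metis exp_ln)
    have "g t > 0" "1 - g t > 0" using interior[of t] t by auto
    hence "(27/2) powr (-3/10) * (g t powr (3/10 - 1) * (1 - g t) powr (1/5 - 1) * g' t)
      = exp (-3/10 * e) * (exp ((3/10 - 1) * (e + ln t + 3 * d - 2 * c))
          * exp ((1/5 - 1) * (ln (1 - t) + 5 * a - 2 * c)) * exp (e + 2 * d + 4 * a - 3 * c))"
      by (simp only: powr_def ln_g ln_g1 g'_exp e_def) simp
    also have "\<dots> = exp (-7/10 * ln t) * exp (-4/5 * ln (1 - t)) * exp (-1/10 * d)"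
      unfolding exp_add [symmetric] by (rule arg_cong[where f = exp]) (simp add: field_simps)
    also have "\<dots> = euler_integrand t"
      using pos t by (simp add: euler_integrand_def powr_def d_def)
    finally show ?thesis by (rule sym)
  qed
  have "(euler_integrand has_integral (27/2) powr (-3/10) *
          (incomplete_Beta (3/10) (1/5) (g (16/25)) - incomplete_Beta (3/10) (1/5) (g 0))) {0..16/25}"
  proof (rule has_integral_Beta_substitution)
    show "continuous_on {0..16/25} g"
      using deriv polyC_pos by (intro continuous_at_imp_continuous_on ballI DERIV_isCont) (auto simp: less_le)
    show "(g has_field_derivative g' t) (at t)" if "t \<in> {0<..<16/25}" for t
      using that polyC_pos[of t] by (intro deriv) auto
    show "g t \<in> {0<..<1}" if "t \<in> {0<..<16/25}" for t
      using that by (rule interior)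
    show "euler_integrand t = (27/2) powr (-3/10) * (g t powr (3/10 - 1) * (1 - g t) powr (1/5 - 1) * g' t)"
      if "t \<in> {0<..<16/25}" for t
      using that by (rule integrand_eq)
  qed (auto simp: g_ends)
  thus ?thesis by (simp add: g_ends incomplete_Beta_1)
qed

text \<open>Here \<open>g = - 1 / W\<close>, and \<open>s\<close> is the sign of the cubic on the segment.\<close>
lemma has_integral_right_segment:
  fixes s :: real
  defines "g \<equiv> \<lambda>t. 1 - (polyC t)\<^sup>2 / (27/2 * (t * polyD t ^ 3))"
  assumes lr: "16/25 \<le> l" "l \<le> r" "r \<le> 1" and s: "\<bar>s\<bar> = 1"
    and sC: "\<And>t. t \<in> {l<..<r} \<Longrightarrow> s * polyC t > 0"
  shows "(euler_integrand has_integral s * (27/2) powr (-3/10) *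
           (incomplete_Beta (1/5) (1/2) (g r) - incomplete_Beta (1/5) (1/2) (g l))) {l..r}"
proof -
  \<comment> \<open>The sign of this derivative is that of \<open>polyC\<close> where
    \<open>polyA\<close> is nonzero, so \<open>s * g'\<close> is its absolute value inside the
    segment.\<close>
  define g' where "g' = (\<lambda>t. polyC t * polyA t ^ 4 / (27/2 * (t ^ 2 * polyD t ^ 4)))"
  have D_pos: "polyD t > 0" if "t \<le> 1" for t using that by (simp add: polyD_def)
  \<comment> \<open>\<open>polyA\<close> is negative beyond 16/25; the odd power of
    \<open>- polyA t\<close> absorbs the sign, leaving nonnegative factors.\<close>
  have g_eq: "g t = (1 - t) * (- polyA t) ^ 5 / (27/2 * (t * polyD t ^ 3))" if "t > 0" "t \<le> 1" for t
  proof -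
    have "(1 - t) * (- polyA t) ^ 5 = 27/2 * (t * polyD t ^ 3) - (polyC t)\<^sup>2"
      using cover_identity[of t] by simp
    thus ?thesis using that D_pos[of t] by (simp add: g_def diff_divide_distrib)
  qed
  have deriv: "(g has_field_derivative g' t) (at t)" if "t > 0" "t \<le> 1" for t
  proof -
    let ?c = "75/32 - 13125/1024 * t + 9375/1024 * t^2"
    have D: "polyD t \<noteq> 0" using D_pos that by force
    have "((\<lambda>t. (polyC t)\<^sup>2) has_field_derivative of_nat 2 * (?c * polyC t ^ (2 - Suc 0))) (at t)"
      by (intro DERIV_power DERIV_polyC)
    hence "(g has_field_derivative 0 -
       (of_nat 2 * (?c * polyC t ^ (2 - Suc 0)) * (27/2 * (t * polyD t ^ 3)) - (polyC t)\<^sup>2 * (27/2 * (polyD t ^ 2 * (1 - 125/32 * t))))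
         / ((27/2 * (t * polyD t ^ 3)) * (27/2 * (t * polyD t ^ 3)))) (at t)"
      unfolding g_def using that D by (intro DERIV_diff DERIV_const DERIV_divide DERIV_cmult DERIV_t_polyD_cubed) auto
    also have "0 -
       (of_nat 2 * (?c * polyC t ^ (2 - Suc 0)) * (27/2 * (t * polyD t ^ 3)) - (polyC t)\<^sup>2 * (27/2 * (polyD t ^ 2 * (1 - 125/32 * t))))
         / ((27/2 * (t * polyD t ^ 3)) * (27/2 * (t * polyD t ^ 3)))
       = ((27/2 * polyD t ^ 2) * (polyC t * ((1 - 125/32 * t) * polyC t - 2 * t * polyD t * ?c))) / ((27/2 * polyD t ^ 2) * (27/2 * (t ^ 2 * polyD t ^ 4)))"
      unfolding diff_0 minus_divide_left
      by (rule arg_cong2[where f = "(/)"]) (simp_all add: power2_eq_square power3_eq_cube power4_eq_xxxx algebra_simps)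
    also have "\<dots> = g' t"
      using D by (simp only: wronskian_identity g'_def) simp
    finally show ?thesis .
  qed
  have bounds: "g t \<in> {0..1}" if "t \<ge> 16/25" "t \<le> 1" for t
  proof -
    have "g t \<ge> 0"
      using that D_pos[of t] by (subst g_eq) (auto simp: polyA_def intro!: divide_nonneg_pos mult_nonneg_nonneg)
    moreover have "g t \<le> 1"
      using that D_pos[of t] by (simp add: g_def)
    ultimately show ?thesis by simp
  qed
  have A_neg: "polyA t < 0" if "t > 16/25" for t using that by (simp add: polyA_def)
  have interior: "g t \<in> {0<..<1}" if "t \<in> {l<..<r}" for t
  proof -
    have "t > 16/25" "t < 1" "polyC t \<noteq> 0" using that lr sC[OF that] by auto
    moreover have "g t > 0"
      using \<open>t > 16/25\<close> \<open>t < 1\<close> D_pos[of t] A_neg[of t]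
      by (subst g_eq) (auto intro!: divide_pos_pos mult_pos_pos zero_less_power simp del: power_minus_odd)
    ultimately show ?thesis using D_pos[of t] by (simp add: g_def)
  qed
  \<comment> \<open>With \<open>W = -1 / g\<close>, the form
    \<open>|W|^(-7/10) |1+W|^(-1/2) |dW|\<close> becomes
    \<open>g^(-4/5) (1-g)^(-1/2) |dg|\<close>.\<close>
  have integrand_eq: "euler_integrand t = s * (27/2) powr (-3/10) * (g t powr (1/5 - 1) * (1 - g t) powr (1/2 - 1) * g' t)"
    if "t \<in> {l<..<r}" for t
  proof -
    have t: "16/25 < t" "t < 1" using that lr by auto
    have pos: "- polyA t > 0" "s * polyC t > 0" "polyD t > 0" "1 - t > 0" "t > 0"
      using t A_neg[of t] D_pos[of t] sC[OF that] by auto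
    have s2: "s * s = 1" using s by (metis abs_mult_self_eq mult_1)
    define a c d e where "a = ln (- polyA t)" and "c = ln (s * polyC t)" and "d = ln (polyD t)" and "e = ln (27/2 :: real)"
    have "(polyC t)\<^sup>2 = (s * polyC t)\<^sup>2"
      using s2 by (simp add: power_mult_distrib power2_eq_square[of s])
    hence "1 - g t = (s * polyC t)\<^sup>2 / (27/2 * (t * polyD t ^ 3))"
      by (simp add: g_def)
    moreover have "ln ((s * polyC t)\<^sup>2 / (27/2 * (t * polyD t ^ 3))) = 2 * c - (e + (ln t + 3 * d))"
    proof -
      have "ln ((s * polyC t)\<^sup>2 / (27/2 * (t * polyD t ^ 3))) = ln ((s * polyC t)\<^sup>2) - ln (27/2 * (t * polyD t ^ 3))"
        using pos by (intro ln_divide_pos) auto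
      also have "ln ((s * polyC t)\<^sup>2) = 2 * c"
        unfolding c_def using pos ln_realpow[of "s * polyC t" 2] by (simp only: of_nat_numeral)
      also have "ln (27/2 * (t * polyD t ^ 3)) = e + ln (t * polyD t ^ 3)"
        unfolding e_def using pos by (intro ln_mult_pos) auto
      also have "ln (t * polyD t ^ 3) = ln t + 3 * d"
        using pos by (simp add: d_def ln_mult ln_realpow)
      finally show ?thesis .
    qed
    ultimately have ln_g1: "ln (1 - g t) = 2 * c - e - ln t - 3 * d"
      by simp
    have ln_g: "ln (g t) = ln (1 - t) + 5 * a - e - ln t - 3 * d"
      unfolding a_def d_def e_def using pos
      by (subst g_eq) (simp_all add: ln_mult ln_div ln_realpow del: ln_divide_pos power_minus_odd)
    define m n where "m = s * polyC t" and "n = - polyA t"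
    have mn: "m > 0" "n > 0" using pos by (auto simp: m_def n_def)
    have "s * g' t = m * n ^ 4 / (27/2 * (t ^ 2 * polyD t ^ 4))"
      by (simp add: g'_def m_def n_def)
    moreover have "m * n ^ 4 / (27/2 * (t ^ 2 * polyD t ^ 4)) > 0"
      using pos mn by simp
    moreover have "ln (m * n ^ 4 / (27/2 * (t ^ 2 * polyD t ^ 4))) = (c + 4 * a) - (e + (2 * ln t + 4 * d))"
    proof -
      have "ln (m * n ^ 4 / (27/2 * (t ^ 2 * polyD t ^ 4))) = ln (m * n ^ 4) - ln (27/2 * (t ^ 2 * polyD t ^ 4))"
        using pos mn by (intro ln_divide_pos) auto
      also have "ln (m * n ^ 4) = c + 4 * a"
        using mn by (simp add: c_def a_def ln_mult ln_realpow flip: m_def n_def)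
      also have "ln (27/2 * (t ^ 2 * polyD t ^ 4)) = e + ln (t ^ 2 * polyD t ^ 4)"
        unfolding e_def using pos by (intro ln_mult_pos) auto
      also have "ln (t ^ 2 * polyD t ^ 4) = 2 * ln t + 4 * d"
        using pos by (simp add: d_def ln_mult ln_realpow)
      finally show ?thesis .
    qed
    ultimately have g'_exp: "s * g' t = exp ((c + 4 * a) - (e + (2 * ln t + 4 * d)))"
      by (metis exp_ln)
    have "g t > 0" "1 - g t > 0" using interior[OF that] by auto
    have "s * (27/2) powr (-3/10) * (g t powr (1/5 - 1) * (1 - g t) powr (1/2 - 1) * g' t)
      = (27/2) powr (-3/10) * (g t powr (1/5 - 1) * (1 - g t) powr (1/2 - 1) * (s * g' t))"
      by (simp only: mult_ac)
    also have "\<dots> = exp (-3/10 * e) * (exp ((1/5 - 1) * (ln (1 - t) + 5 * a - e - ln t - 3 * d))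
          * exp ((1/2 - 1) * (2 * c - e - ln t - 3 * d)) * exp ((c + 4 * a) - (e + (2 * ln t + 4 * d))))"
      using \<open>g t > 0\<close> \<open>1 - g t > 0\<close> by (simp only: powr_def ln_g ln_g1 g'_exp e_def) simp
    also have "\<dots> = exp (-7/10 * ln t) * exp (-4/5 * ln (1 - t)) * exp (-1/10 * d)"
      unfolding exp_add [symmetric] by (rule arg_cong[where f = exp]) (simp add: field_simps)
    also have "\<dots> = euler_integrand t"
      using pos t by (simp add: euler_integrand_def powr_def d_def)
    finally show ?thesis by (rule sym)
  qed
  show ?thesis
  proof (rule has_integral_Beta_substitution)
    show "continuous_on {l..r} g"
      using lr by (intro continuous_at_imp_continuous_on ballI DERIV_isCont[OF deriv]) auto
    show "(g has_field_derivative g' t) (at t)" if "t \<in> {l<..<r}" for t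
      using that lr by (intro deriv) auto
  qed (use lr bounds interior integrand_eq in auto)
qed

section \<open>Assembly of the segments and evaluation\<close>

text \<open>The three contributions add up to the factor
  \<open>1 + 2 * sin (3*pi/10) = (3 + sqrt 5) / 2\<close>.\<close>

lemma has_integral_euler_integrand:
  "(euler_integrand has_integral (27/2) powr (-3/10) * (3 + sqrt 5) / 2 * Beta (3/10) (1/5)) {0..1}"
proof -
  obtain r where r: "16/25 < r" "r < 1" "polyC r = 0"
    using polyC_root by blast
  define g where "g = (\<lambda>t. 1 - (polyC t)\<^sup>2 / (27/2 * (t * polyD t ^ 3)))"
  have g_vals: "g (16/25) = 0" "g r = 1" "g 1 = 0"
    using r by (simp_all add: g_def polyC_def[of 1] polyC_def[of "16/25"] polyD_def power2_eq_square power3_eq_cube)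
  have "polyC t > 0" if "t \<in> {16/25<..<r}" for t
    using polyC_strict_antimono[of t r] that r by auto
  hence "(euler_integrand has_integral 1 * (27/2) powr (-3/10) *
      (incomplete_Beta (1/5) (1/2) (g r) - incomplete_Beta (1/5) (1/2) (g (16/25)))) {16/25..r}"
    unfolding g_def using r by (intro has_integral_right_segment) auto
  moreover have "polyC t < 0" if "t \<in> {r<..<1}" for t
    using polyC_strict_antimono[of r t] that r by auto
  \<comment> \<open>Here \<open>g\<close> falls from 1 to 0, and \<open>s = -1\<close> makes the
    contribution positive.\<close>
  hence "(euler_integrand has_integral (-1) * (27/2) powr (-3/10) *
      (incomplete_Beta (1/5) (1/2) (g 1) - incomplete_Beta (1/5) (1/2) (g r))) {r..1}"
    unfolding g_def using r by (intro has_integral_right_segment) auto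
  ultimately have "(euler_integrand has_integral (27/2) powr (-3/10) * Beta (1/5) (1/2) + (27/2) powr (-3/10) * Beta (1/5) (1/2)) {16/25..1}"
    using r by (intro has_integral_combine[of "16/25" r 1]) (simp_all add: g_vals incomplete_Beta_1)
  hence "(euler_integrand has_integral (27/2) powr (-3/10) * Beta (3/10) (1/5) +
      ((27/2) powr (-3/10) * Beta (1/5) (1/2) + (27/2) powr (-3/10) * Beta (1/5) (1/2))) {0..1}"
    by (intro has_integral_combine[OF _ _ has_integral_left_segment]) auto
  also have "(27/2) powr (-3/10) * Beta (3/10) (1/5) +
      ((27/2) powr (-3/10) * Beta (1/5) (1/2) + (27/2) powr (-3/10) * Beta (1/5) (1/2)) =
      (27/2) powr (-3/10) * (3 + sqrt 5) / 2 * Beta (3/10) (1/5 :: real)"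
    unfolding Beta_fifth_half sin_3pi_10 by (simp add: field_simps)
  finally show ?thesis .
qed

theorem mainTheorem3:
  shows "hyp2f1 (1/10) (3/10) (1/2) (125/128) =
           complex_of_real (1/6 * 2 powr (3/10) * root 10 3 * (sqrt 5 + 3))"
proof -
  define I :: real where "I = (27/2) powr (-3/10) * (3 + sqrt 5) / 2 * Beta (3/10) (1/5)"
  have "((\<lambda>t. t powr (3/10 - 1) * (1 - t) powr (1/2 - 3/10 - 1) * (1 - 125/128 * t) powr (-(1/10)))
          has_integral I) {0..1}"
    using has_integral_euler_integrand by (simp add: euler_integrand_def [abs_def] polyD_def I_def)
  hence sums: "(\<lambda>n. pochhammer (1/10) n * pochhammer (3/10) n / (pochhammer (1/2) n * pochhammer 1 n) * (125/128) ^ n)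
           sums (I / Beta (3/10) (1/2 - 3/10))"
    by (intro hypergeometric_sums_Euler_integral) auto
  have "Beta (3/10) (1/5 :: real) \<noteq> 0"
    using Beta_real_pos[of "3/10" "1/5"] by simp
  \<comment> \<open>As \<open>27/2 = 3^3 / 2\<close>, the power is
    \<open>2^(3/10) * 3^(-9/10)\<close>, and \<open>3^(-9/10) = 3^(1/10) / 3\<close>.\<close>
  moreover have "(27/2) powr (-3/10) * (3 + sqrt 5) / 2 = 1/6 * 2 powr (3/10) * root 10 3 * (sqrt 5 + 3)"
  proof -
    have "(27/2 :: real) powr (-3/10) = exp (-3/10 * (3 * ln 3 - ln 2))"
      using ln_realpow[of "3::real" 3] by (simp add: powr_def ln_div)
    also have "\<dots> = exp (3/10 * ln 2) * exp (1/10 * ln 3) / exp (ln 3)"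
      unfolding exp_add [symmetric] exp_diff [symmetric]
      by (rule arg_cong[where f = exp]) (simp add: field_simps)
    also have "\<dots> = 2 powr (3/10) * root 10 3 / 3"
      by (simp add: powr_def root_powr_inverse)
    finally have "(27/2 :: real) powr (-3/10) = 2 powr (3/10) * root 10 3 / 3" .
    thus ?thesis by (simp only:) (simp add: algebra_simps)
  qed
  ultimately have "I / Beta (3/10) (1/2 - 3/10) = 1/6 * 2 powr (3/10) * root 10 3 * (sqrt 5 + 3)"
    by (simp add: I_def)
  with sums have "(\<lambda>n. pochhammer (1/10) n * pochhammer (3/10) n / (pochhammer (1/2) n * pochhammer 1 n) * (125/128) ^ n)
      sums (1/6 * 2 powr (3/10) * root 10 3 * (sqrt 5 + 3))"
    by (simp only:)
  hence "(\<lambda>n. complex_of_real (pochhammer (1/10) n * pochhammer (3/10) n / (pochhammer (1/2) n * pochhammer 1 n) * (125/128) ^ n))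
      sums complex_of_real (1/6 * 2 powr (3/10) * root 10 3 * (sqrt 5 + 3))"
    by (simp only: sums_of_real_iff)
  thus ?thesis
    unfolding hyp2f1_def by (intro sums_unique [symmetric]) (simp flip: pochhammer_of_real)
qed

end
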